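(* Let $(\Omega,\rho)$ be a compact metric space equipped with a Borel probability measure $P$ and let $\mathbb{M}$ be a dense subset of $\Omega$. A set $S\subset\mathbb{M}$ belongs to $\mathcal{Y}$ if and only if for each sequence $\{x_n\}$ of elements of $\mathbb{M}$ that is uniformly distributed in $\Omega$ the set $\mathbb{A}(\{x_n\},S)=\{n: x_n\in S\}$ belongs to $\mathcal{D}$; and in this case $d\big(\mathbb{A}(\{x_n\},S)\big)=\pi(S)$ for each such sequence.
   Context: For $S\subset\mathbb{M}$ put $\pi^\ast(S)=P(cl(S))$, where $cl$ is the closure in $\Omega$. Let $\mathcal{Y}$ be the system of all $A\subset\mathbb{M}$ with $\pi^\ast(A)+\pi^\ast(\mathbb{M}\setminus A)=1$, and let $\pi=\pi^\ast|_{\mathcal{Y}}$ be the restriction of $\pi^\ast$ to $\mathcal{Y}$. A sequence $\{a_n\}$ of elements of $\Omega$ is uniformly distributed in $\Omega$ if $\lim_{N\to\infty}\frac1N\sum_{n=1}^N g(a_n)=\int g\,dP$ for every continuous real function $g$ on $\Omega$. A set $A$ of non-negative integers has asymptotic density if the limit $d(A)=\lim_{n\to\infty}\frac1n|\{k\le n: k\in A\}|$ exists; $d(A)$ is its asymptotic density, and $\mathcal{D}$ denotes the system of all sets having asymptotic density. *)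

theory Defs
  imports "HOL-Probability.Probability"
begin

text \<open>The compact metric space \<open>\<Omega>\<close> is a whole type of class \<open>metric_space\<close> with
  \<open>compact UNIV\<close>, so \<open>closure\<close> is the closure in \<open>\<Omega>\<close>. Sequences are indexed from 1: for
  \<open>x :: nat \<Rightarrow> 'a\<close> the value \<open>x 0\<close> is never used.\<close>

definition pi_star :: "'a::metric_space measure \<Rightarrow> 'a set \<Rightarrow> real" where
  "pi_star P S = measure P (closure S)"

definition Y_system :: "'a::metric_space measure \<Rightarrow> 'a set \<Rightarrow> 'a set set" where
  "Y_system P M = {A. A \<subseteq> M \<and> pi_star P A + pi_star P (M - A) = 1}"

definition pi_content :: "'a::metric_space measure \<Rightarrow> 'a set \<Rightarrow> 'a set \<Rightarrow> real" where
  "pi_content P M = restrict (pi_star P) (Y_system P M)"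

definition sequence_in :: "'a set \<Rightarrow> (nat \<Rightarrow> 'a) \<Rightarrow> bool" where
  "sequence_in M x \<longleftrightarrow> (\<forall>n\<ge>1. x n \<in> M)"

definition uniformly_distributed :: "'a::metric_space measure \<Rightarrow> (nat \<Rightarrow> 'a) \<Rightarrow> bool" where
  "uniformly_distributed P a \<longleftrightarrow>
    (\<forall>g::'a \<Rightarrow> real. continuous_on UNIV g \<longrightarrow>
      (\<lambda>N. 1 / real N * (\<Sum>n=1..N. g (a n))) \<longlonglongrightarrow> (\<integral>\<omega>. g \<omega> \<partial>P))"

definition index_set :: "(nat \<Rightarrow> 'a) \<Rightarrow> 'a set \<Rightarrow> nat set" where
  "index_set x S = {n. n \<ge> 1 \<and> x n \<in> S}"

definition density_ratio :: "nat set \<Rightarrow> nat \<Rightarrow> real" where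
  "density_ratio A n = 1 / real n * real (card {k. k \<le> n \<and> k \<in> A})"

definition has_density_sets :: "nat set set" where
  "has_density_sets = {A. convergent (density_ratio A)}"

text \<open>Meaningful only on \<open>has_density_sets\<close>; elsewhere \<open>lim\<close> is unspecified.\<close>

definition asymp_density :: "nat set \<Rightarrow> real" where
  "asymp_density A = lim (density_ratio A)"

end

theory Submission
  imports Defs
begin

text \<open>If \<open>S\<close> lies in the system, the portmanteau bound \<open>limsup \<le> P(F)\<close> for the closed sets
  \<open>F = cl S\<close> and \<open>F = cl (M - S)\<close> pins the density of \<open>{n. x n \<in> S}\<close> down to \<open>P(cl S)\<close>.
  Otherwise \<open>K = cl S \<inter> cl (M - S)\<close> has positive measure. The strong law of large numbers gives a
  uniformly distributed sequence \<open>a\<close> in \<open>\<Omega>\<close> that visits \<open>K\<close> with frequency \<open>P(K)\<close>. Whenever \<open>a n\<close>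
  is in \<open>K\<close>, it can be approximated both from \<open>S\<close> and from \<open>M - S\<close>; small perturbations preserve
  uniform distribution, so switching between the two options on rapidly growing blocks makes
  the density of the visits to \<open>S\<close> oscillate.\<close>

section \<open>Cesaro means\<close>

text \<open>The same expression as in \<open>uniformly_distributed\<close>; it serves both for
  averages of continuous functions and, through indicators, for densities.\<close>

definition cesaro :: "(nat \<Rightarrow> real) \<Rightarrow> nat \<Rightarrow> real" where
  "cesaro u N = 1 / real N * (\<Sum>n=1..N. u n)"

lemma cesaro_add: "cesaro (\<lambda>n. u n + v n) N = cesaro u N + cesaro v N"
  by (simp add: cesaro_def sum.distrib algebra_simps)

lemma cesaro_diff: "cesaro (\<lambda>n. u n - v n) N = cesaro u N - cesaro v N"
  by (simp add: cesaro_def sum_subtractf algebra_simps)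

lemma cesaro_sum: "cesaro (\<lambda>n. \<Sum>i\<in>I. u i n) N = (\<Sum>i\<in>I. cesaro (u i) N)"
proof -
  have "(\<Sum>n=1..N. \<Sum>i\<in>I. u i n) = (\<Sum>i\<in>I. \<Sum>n=1..N. u i n)" by (rule sum.swap)
  then show ?thesis by (simp add: cesaro_def sum_distrib_left)
qed

lemma cesaro_cmult: "cesaro (\<lambda>n. c * u n) N = c * cesaro u N"
  by (simp add: cesaro_def sum_distrib_left mult_ac)

lemma cesaro_mono:
  assumes "\<And>n. n \<ge> 1 \<Longrightarrow> u n \<le> v n"
  shows "cesaro u N \<le> cesaro v N"
  unfolding cesaro_def using assms by (intro mult_left_mono sum_mono) auto

lemma cesaro_cong:
  assumes "\<And>n. n \<ge> 1 \<Longrightarrow> u n = v n"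
  shows "cesaro u = cesaro v"
  unfolding cesaro_def using assms by (intro ext arg_cong2[where f="(*)"] sum.cong) auto

lemma abs_cesaro_le:
  assumes "\<And>n. n \<ge> 1 \<Longrightarrow> \<bar>u n\<bar> \<le> c" "c \<ge> 0"
  shows "\<bar>cesaro u N\<bar> \<le> c"
proof (cases "N = 0")
  case False
  have "\<bar>\<Sum>n=1..N. u n\<bar> \<le> (\<Sum>n=1..N. \<bar>u n\<bar>)" by (rule sum_abs)
  also have "\<dots> \<le> (\<Sum>n=1..N. c)" using assms by (intro sum_mono) auto
  finally show ?thesis using False by (simp add: cesaro_def abs_mult field_simps)
qed (use assms in \<open>simp add: cesaro_def\<close>)

text \<open>The finitely many terms that are not yet small contribute a fixed amount
  \<open>C\<close> to the sum, which division by \<open>N\<close> makes negligible; all later terms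
  are below \<open>e / 2\<close>.\<close>

lemma cesaro_tendsto_0:
  assumes "u \<longlonglongrightarrow> 0"
  shows "cesaro u \<longlonglongrightarrow> 0"
proof (rule LIMSEQ_I)
  fix e :: real assume e: "e > 0"
  then obtain m where m: "\<And>n. n \<ge> m \<Longrightarrow> \<bar>u n\<bar> < e / 2"
    using LIMSEQ_D[OF assms, of "e/2"] by auto
  define C where "C = (\<Sum>n=1..m. \<bar>u n\<bar>)"
  obtain N0 where N0: "real N0 > 2 * C / e" using reals_Archimedean2 by blast
  show "\<exists>no. \<forall>N\<ge>no. norm (cesaro u N - 0) < e"
  proof (intro exI allI impI)
    fix N assume N: "N \<ge> max (max N0 m) 1"
    have "\<bar>\<Sum>n=1..N. u n\<bar> \<le> (\<Sum>n=1..N. \<bar>u n\<bar>)" by (rule sum_abs)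
    also have "\<dots> \<le> (\<Sum>n=1..N. (if n \<le> m then \<bar>u n\<bar> else 0) + e / 2)"
      using m e by (intro sum_mono) (auto simp: not_le intro: less_imp_le)
    also have "\<dots> = (\<Sum>n=1..N. if n \<le> m then \<bar>u n\<bar> else 0) + N * (e / 2)"
      by (simp add: sum.distrib)
    also have "(\<Sum>n=1..N. if n \<le> m then \<bar>u n\<bar> else 0) = C"
      unfolding C_def using N by (intro sum.mono_neutral_cong_right) auto
    finally have "\<bar>\<Sum>n=1..N. u n\<bar> \<le> C + N * (e / 2)" .
    moreover have "C < N * (e / 2)"
    proof -
      have "2 * C / e < N" using N0 N by linarith
      then show ?thesis using e by (simp add: field_simps)
    qed
    ultimately have "\<bar>\<Sum>n=1..N. u n\<bar> < N * e" by simp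
    then show "norm (cesaro u N - 0) < e"
      using N by (simp add: cesaro_def abs_mult field_simps)
  qed
qed

section \<open>Oscillation on factorial blocks\<close>

text \<open>Gives the index of the block between consecutive factorials that contains
  \<open>n\<close>; in \<open>oscillating_choice\<close> its parity decides which sequence is
  used.\<close>

lemma Least_fact_eq:
  assumes "fact k < n" "n \<le> (fact (Suc k) :: nat)"
  shows "(LEAST j. n \<le> fact j) = Suc k"
proof (rule Least_equality)
  fix j assume "n \<le> fact j"
  then have "\<not> j \<le> k" using assms fact_mono_nat[of j k] by (meson le_trans not_le)
  then show "Suc k \<le> j" by simp
qed (rule assms)

text \<open>Only the first \<open>fact k\<close> terms can differ, each by at most 1, and the mean
  is taken over \<open>Suc k * fact k\<close> terms.\<close>

lemma cesaro_fact_diff: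
  assumes "\<And>n. \<bar>u n - w n\<bar> \<le> 1" "\<And>n. fact k < n \<Longrightarrow> n \<le> fact (Suc k) \<Longrightarrow> u n = w n"
  shows "\<bar>cesaro u (fact (Suc k)) - cesaro w (fact (Suc k))\<bar> \<le> 1 / real (Suc k)"
proof -
  have "\<bar>\<Sum>n=1..fact (Suc k). u n - w n\<bar> \<le> (\<Sum>n=1..fact (Suc k). \<bar>u n - w n\<bar>)" by (rule sum_abs)
  also have "\<dots> = (\<Sum>n=1..fact k. \<bar>u n - w n\<bar>)"
    using assms(2) by (intro sum.mono_neutral_right) (auto simp: not_le)
  also have "\<dots> \<le> (\<Sum>n=1..(fact k::nat). 1)" using assms(1) by (intro sum_mono) auto
  finally have *: "\<bar>\<Sum>n=1..fact (Suc k). u n - w n\<bar> \<le> fact k" by simp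
  have "\<bar>cesaro u (fact (Suc k)) - cesaro w (fact (Suc k))\<bar>
      = \<bar>\<Sum>n=1..fact (Suc k). u n - w n\<bar> / real (fact (Suc k))"
    unfolding cesaro_diff[symmetric] by (simp add: cesaro_def abs_mult)
  also have "\<dots> \<le> fact k / real (fact (Suc k))"
    using * by (intro divide_right_mono) auto
  also have "\<dots> = 1 / real (Suc k)"
    unfolding fact_Suc of_nat_mult of_nat_fact of_nat_id by (simp del: of_nat_Suc)
  finally show ?thesis .
qed

lemma oscillating_choice:
  fixes u v :: "nat \<Rightarrow> real"
  assumes u: "cesaro u \<longlonglongrightarrow> \<alpha>" and v: "cesaro v \<longlonglongrightarrow> \<beta>" and "\<alpha> \<noteq> \<beta>"
    and bounded: "\<And>n. \<bar>u n - v n\<bar> \<le> 1"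
  obtains W :: "nat set" where "\<not> convergent (cesaro (\<lambda>n. if n \<in> W then u n else v n))"
proof -
  \<comment> \<open>The choice changes at factorials: at \<open>N = (k + 1)!\<close> the terms up to \<open>k!\<close> carry weight
    only \<open>1 / (k + 1)\<close>, so the mean is close to that of the sequence used on the last block.\<close>
  define W :: "nat set" where "W = {n. even (LEAST k. n \<le> fact k)}"
  define w where "w = (\<lambda>n. if n \<in> W then u n else v n)"
  \<comment> \<open>If \<open>t\<close> agrees with \<open>w\<close> on infinitely many blocks,
    their means at the ends of these blocks differ by a null sequence, so the two limits
    coincide.\<close>
  have lim: "l = L" if l: "cesaro t \<longlonglongrightarrow> l" and L: "cesaro w \<longlonglongrightarrow> L"
    and s: "strict_mono (s :: nat \<Rightarrow> nat)"
    and t: "\<And>n. \<bar>t n - w n\<bar> \<le> 1" "\<And>k n. fact (s k) < n \<Longrightarrow> n \<le> fact (Suc (s k)) \<Longrightarrow> t n = w n"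
    for t :: "nat \<Rightarrow> real" and l L s
  proof -
    let ?f = "\<lambda>k. fact (Suc (s k)) :: nat"
    have f: "filterlim ?f at_top sequentially"
    proof (rule filterlim_at_top_mono)
      show "filterlim s at_top sequentially" by (rule filterlim_subseq[OF s])
      show "\<forall>\<^sub>F k in sequentially. s k \<le> ?f k"
        by (intro always_eventually allI order_trans[OF le_SucI[OF order_refl] fact_ge_self])
    qed
    have "(\<lambda>k. 1 / real (Suc (s k))) \<longlonglongrightarrow> 0"
      using LIMSEQ_subseq_LIMSEQ[OF LIMSEQ_Suc[OF lim_1_over_n] s] by (simp add: o_def)
    then have "(\<lambda>k. cesaro t (?f k) - cesaro w (?f k)) \<longlonglongrightarrow> 0"
      by (rule Lim_null_comparison[rotated])
         (use cesaro_fact_diff[OF t] in \<open>auto intro!: always_eventually\<close>)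
    moreover have "(\<lambda>k. cesaro t (?f k) - cesaro w (?f k)) \<longlonglongrightarrow> l - L"
      by (intro tendsto_diff filterlim_compose[OF l f] filterlim_compose[OF L f])
    ultimately show "l = L" using LIMSEQ_unique by fastforce
  qed
  have "\<not> convergent (cesaro w)"
  proof
    assume "convergent (cesaro w)"
    then obtain L where L: "cesaro w \<longlonglongrightarrow> L" by (auto simp: convergent_def)
    \<comment> \<open>For \<open>s k = 2 * k + 1\<close> the block has the even index
      \<open>Suc (s k)\<close>, so it lies in \<open>W\<close> and \<open>w\<close> equals
      \<open>u\<close> on it; even \<open>s k\<close> give \<open>v\<close> in the same way.\<close>
    have "\<alpha> = L"
      by (rule lim[OF u L, of "\<lambda>k. 2 * k + 1"])
         (use bounded Least_fact_eq in \<open>auto simp: strict_mono_def w_def W_def simp del: fact_Suc\<close>)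
    moreover have "\<beta> = L"
      by (rule lim[OF v L, of "\<lambda>k. 2 * k"])
         (use bounded Least_fact_eq in \<open>auto simp: strict_mono_def w_def W_def abs_minus_commute simp del: fact_Suc\<close>)
    ultimately show False using \<open>\<alpha> \<noteq> \<beta>\<close> by simp
  qed
  then show ?thesis using that w_def by blast
qed

section \<open>Uniform distribution and density as Cesaro means\<close>

lemma uniformly_distributed_iff:
  "uniformly_distributed P a \<longleftrightarrow>
    (\<forall>g. continuous_on UNIV g \<longrightarrow> cesaro (\<lambda>n. g (a n)) \<longlonglongrightarrow> (\<integral>\<omega>. g \<omega> \<partial>P))"
  by (simp add: uniformly_distributed_def cesaro_def [abs_def])

text \<open>The index 0 is excluded from \<open>index_set\<close>, so counting
  \<open>k \<le> N\<close> agrees with the sum from 1 to \<open>N\<close>.\<close>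

lemma density_ratio_eq_cesaro:
  "density_ratio (index_set x S) = cesaro (\<lambda>n. indicator S (x n))"
proof
  fix N
  have "{k. k \<le> N \<and> k \<in> index_set x S} = {k \<in> {1..N}. x k \<in> S}"
    by (auto simp: index_set_def)
  then show "density_ratio (index_set x S) N = cesaro (\<lambda>n. indicator S (x n)) N"
    by (simp add: density_ratio_def cesaro_def indicator_def of_bool_def sum.If_cases Int_def)
qed

section \<open>Strong law of large numbers for functions with values in [0,1]\<close>

text \<open>Independence means that the joint distribution is the product of the marginals; here the
  joint map is the identity and every marginal is \<open>P\<close>.\<close>

lemma indep_vars_PiM_coordinates:
  assumes "prob_space P"
  shows "prob_space.indep_vars (Pi\<^sub>M UNIV (\<lambda>_. P)) (\<lambda>_. P) (\<lambda>i x. x i) (UNIV :: 'i set)"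
proof -
  let ?Q = "Pi\<^sub>M (UNIV :: 'i set) (\<lambda>_. P)"
  interpret Q: prob_space ?Q using assms by (intro prob_space_PiM)
  have "distr ?Q ?Q (\<lambda>x. \<lambda>i\<in>UNIV. x i) = ?Q" by (simp add: restrict_def distr_id2)
  moreover have "(\<Pi>\<^sub>M i\<in>UNIV. distr ?Q P (\<lambda>x. x i)) = ?Q"
    using assms by (intro PiM_cong refl distr_PiM_component) auto
  ultimately show ?thesis by (subst Q.indep_vars_iff_distr_eq_PiM') auto
qed

text \<open>Hoeffding's inequality makes the probabilities of a deviation by \<epsilon> summable in
  \<open>N\<close>, and Borel-Cantelli then excludes all but finitely many such deviations almost
  surely.\<close>

lemma strong_law_bounded:
  fixes f :: "'a \<Rightarrow> real"
  assumes P: "prob_space P" and f [measurable]: "f \<in> borel_measurable P"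
    and bounded: "\<And>x. f x \<in> {0..1}"
  shows "AE x in Pi\<^sub>M UNIV (\<lambda>_. P). cesaro (\<lambda>n. f (x n)) \<longlonglongrightarrow> (\<integral>\<omega>. f \<omega> \<partial>P)"
proof -
  let ?Q = "Pi\<^sub>M (UNIV :: nat set) (\<lambda>_. P)" and ?\<mu> = "\<integral>\<omega>. f \<omega> \<partial>P"
  interpret P: prob_space P by fact
  interpret Q: prob_space ?Q using P by (intro prob_space_PiM)
  have indep: "Q.indep_vars (\<lambda>_. borel) (\<lambda>n x. f (x n)) UNIV"
    by (rule Q.indep_vars_compose2[OF indep_vars_PiM_coordinates[OF P]]) simp
  have comp: "distr ?Q P (\<lambda>x. x n) = P" for n
    using P by (intro distr_PiM_component) auto
  have distr: "distr ?Q borel (\<lambda>x. f (x n)) = distr P borel f" for n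
    using distr_distr[of f P borel "\<lambda>x. x n" ?Q] comp[of n] by (simp add: o_def)
  have ex: "Q.expectation (\<lambda>x. f (x 0)) = ?\<mu>"
    using integral_distr[of "\<lambda>x. x 0" ?Q P f] comp[of 0] by simp
  have close: "AE x in ?Q. \<forall>\<^sub>F N in sequentially. \<bar>cesaro (\<lambda>n. f (x n)) N - ?\<mu>\<bar> < \<epsilon>"
    if \<epsilon>: "\<epsilon> > 0" for \<epsilon>
  proof -
    define A where "A N = {x \<in> space ?Q. \<epsilon> \<le> \<bar>cesaro (\<lambda>n. f (x n)) N - ?\<mu>\<bar>}" for N
    have [measurable]: "A N \<in> sets ?Q" for N unfolding A_def cesaro_def by measurable
    \<comment> \<open>Each variable has range of length 1, so the Hoeffding bound is geometric in
      \<open>N\<close>.\<close>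
    have "Q.prob (A N) \<le> 2 * exp (- 2 * \<epsilon>\<^sup>2) ^ N" if "N \<ge> 1" for N
    proof -
      interpret H: Hoeffding_ineq_iid ?Q "{1..N}" "\<lambda>n x. f (x n)" "\<lambda>x. f (x 0)" 0 1 ?\<mu>
      proof unfold_locales
        show "Q.indep_vars (\<lambda>_. borel) (\<lambda>n x. f (x n)) {1..N}"
          by (rule Q.indep_vars_subset[OF indep]) simp
        show "distr ?Q borel (\<lambda>x. f (x n)) = distr ?Q borel (\<lambda>x. f (x 0))" for n
          by (simp only: distr)
        show "AE x in ?Q. f (x 0) \<in> {0..1}"
          using bounded by blast
        show "?\<mu> \<equiv> Q.expectation (\<lambda>x. f (x 0))"
          by (simp only: ex)
        show "(\<lambda>x. f (x 0)) \<in> borel_measurable ?Q"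
          by measurable
      qed simp
      show ?thesis
        using H.Hoeffding_ineq_abs_ge'[of \<epsilon>] \<epsilon> that
        by (simp add: A_def cesaro_def exp_of_nat_mult[symmetric] mult_ac)
    qed
    then have "summable (\<lambda>N. Q.prob (A N))"
      using \<epsilon> by (intro summable_comparison_test[OF _
            summable_mult[OF summable_geometric[of "exp (- 2 * \<epsilon>\<^sup>2)"], of 2]])
        (auto intro!: exI[of _ 1])
    then have "AE x in ?Q. \<forall>\<^sub>F N in sequentially. x \<in> space ?Q - A N"
      by (intro borel_cantelli_AE1) (auto simp: Q.emeasure_eq_measure)
    then show ?thesis
      by (rule AE_mp) (auto intro!: AE_I2 elim!: eventually_mono simp: A_def)
  qed
  \<comment> \<open>Countably many tolerances \<open>1 / real (Suc k)\<close> allow one common null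
    set and still force convergence.\<close>
  have "AE x in ?Q. \<forall>k. \<forall>\<^sub>F N in sequentially. \<bar>cesaro (\<lambda>n. f (x n)) N - ?\<mu>\<bar> < 1 / real (Suc k)"
    unfolding AE_all_countable using close by simp
  then show ?thesis
  proof (rule AE_mp, intro AE_I2 impI)
    fix x
    assume *: "\<forall>k. \<forall>\<^sub>F N in sequentially. \<bar>cesaro (\<lambda>n. f (x n)) N - ?\<mu>\<bar> < 1 / real (Suc k)"
    show "cesaro (\<lambda>n. f (x n)) \<longlonglongrightarrow> ?\<mu>"
    proof (rule tendstoI)
      fix e :: real assume "e > 0"
      then obtain k where "1 / real (Suc k) < e" using nat_approx_posE by blast
      with *[rule_format, of k] show "\<forall>\<^sub>F N in sequentially. dist (cesaro (\<lambda>n. f (x n)) N) ?\<mu> < e"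
        by (auto elim!: eventually_mono simp: dist_real_def)
    qed
  qed
qed

text \<open>Countably many almost sure events hold simultaneously almost surely, and an almost sure
  event of a probability space is nonempty.\<close>

lemma typical_sequence_exists:
  fixes A :: "'i::countable \<Rightarrow> 'a set"
  assumes P: "prob_space P" and A: "\<And>i. A i \<in> sets P"
  obtains a :: "nat \<Rightarrow> 'a"
  where "\<And>i. cesaro (\<lambda>n. indicator (A i) (a n)) \<longlonglongrightarrow> measure P (A i)"
proof -
  let ?Q = "Pi\<^sub>M (UNIV :: nat set) (\<lambda>_. P)"
  interpret P: prob_space P by fact
  interpret Q: prob_space ?Q using P by (intro prob_space_PiM)
  have "AE x in ?Q. cesaro (\<lambda>n. indicator (A i) (x n)) \<longlonglongrightarrow> measure P (A i)" for i
    using strong_law_bounded[OF P, of "indicator (A i)"] A[of i] sets.sets_into_space[OF A[of i]]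
    by (simp add: Int_absorb1 Int_absorb2 del: indicator_simps)
  then have "AE x in ?Q. \<forall>i. cesaro (\<lambda>n. indicator (A i) (x n)) \<longlonglongrightarrow> measure P (A i)"
    unfolding AE_all_countable by blast
  from eventually_happens[OF this] Q.ae_filter_bot show ?thesis using that by (auto simp: trivial_limit_def)
qed

section \<open>Existence and stability of uniformly distributed sequences\<close>

text \<open>By compactness every continuous function is a uniform limit of step functions on finite
  partitions into small pieces, one partition for each scale \<open>k\<close>. Right frequencies on
  these countably many pieces therefore suffice, and \<open>B\<close> joins the list as one more
  set.\<close>

lemma uniformly_distributed_exists:
  fixes P :: "'a::metric_space measure"
  assumes compact: "compact (UNIV :: 'a set)"
    and P: "prob_space P" and sets_P: "sets P = sets borel" and B: "B \<in> sets P"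
  obtains a where "uniformly_distributed P a"
    "cesaro (\<lambda>n. indicator B (a n)) \<longlonglongrightarrow> measure P B"
proof -
  interpret P: prob_space P by fact
  have "\<exists>(c :: nat \<Rightarrow> 'a) m. UNIV \<subseteq> (\<Union>i<m. ball (c i) (1 / real (Suc k)))" for k
  proof -
    obtain K :: "'a set" where "finite K" and K: "UNIV \<subseteq> (\<Union>x\<in>K. ball x (1 / real (Suc k)))"
      using compact unfolding compact_eq_totally_bounded
      by (metis of_nat_0_less_iff zero_less_Suc zero_less_divide_1_iff)
    then obtain c m where "K = c ` {i::nat. i < m}" using finite_imp_nat_seg_image_inj_on by metis
    with K have "UNIV \<subseteq> (\<Union>i<m. ball (c i) (1 / real (Suc k)))"
      by (simp add: lessThan_def del: of_nat_Suc)
    then show ?thesis by blast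
  qed
  then obtain c :: "nat \<Rightarrow> nat \<Rightarrow> 'a" and m
    where cover: "\<And>k. UNIV \<subseteq> (\<Union>i<m k. ball (c k i) (1 / real (Suc k)))" by metis
  \<comment> \<open>Disjoint pieces let a step function take a single prescribed value on each of
    them.\<close>
  define E where "E k = disjointed (\<lambda>i. ball (c k i) (1 / real (Suc k)))" for k
  have E_sets: "E k i \<in> sets P" for k i
    unfolding E_def sets_P disjointed_def by (intro sets.Diff sets.finite_UN) auto
  have disj: "disjoint_family (E k)" for k
    unfolding E_def by (rule disjoint_family_disjointed)
  \<comment> \<open>One countable family holds all test sets: \<open>None\<close> stands for
    \<open>B\<close>, \<open>Some (k, i)\<close> for a piece.\<close>
  define C where "C = case_option B (\<lambda>(k, i). E k i)"
  have "C j \<in> sets P" for j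
    using B E_sets by (auto simp: C_def split: option.split)
  then obtain a where a: "\<And>j. cesaro (\<lambda>n. indicator (C j) (a n)) \<longlonglongrightarrow> measure P (C j)"
    using typical_sequence_exists[OF P, of C] by blast
  have aB: "cesaro (\<lambda>n. indicator B (a n)) \<longlonglongrightarrow> measure P B"
    using a[of None] by (simp add: C_def)
  have aE: "cesaro (\<lambda>n. indicator (E k i) (a n)) \<longlonglongrightarrow> measure P (E k i)" for k i
    using a[of "Some (k, i)"] by (simp add: C_def)
  have "uniformly_distributed P a"
    unfolding uniformly_distributed_iff
  proof (intro allI impI)
    fix g :: "'a \<Rightarrow> real" assume g: "continuous_on UNIV g"
    have g_int: "integrable P g"
    proof -
      obtain b where "\<And>x. norm (g x) \<le> b"
        using compact_imp_bounded[OF compact_continuous_image[OF g compact]]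
        by (auto simp: bounded_iff)
      then show ?thesis
        using borel_measurable_continuous_onI[OF g] sets_P
        by (intro P.integrable_const_bound[of _ b]) (auto cong: measurable_cong_sets)
    qed
    show "cesaro (\<lambda>n. g (a n)) \<longlonglongrightarrow> (\<integral>\<omega>. g \<omega> \<partial>P)"
    proof (rule tendstoI)
      fix e :: real assume "e > 0"
      then obtain d where "d > 0" and d: "\<And>x y. dist x y < d \<Longrightarrow> dist (g x) (g y) < e / 3"
        using compact_uniformly_continuous[OF g compact]
        unfolding uniformly_continuous_on_def
        by (metis UNIV_I dist_commute divide_pos_pos zero_less_numeral)
      obtain k where k: "1 / real (Suc k) < d" using \<open>d > 0\<close> nat_approx_posE by blast
      \<comment> \<open>\<open>h\<close> takes on each piece the value of \<open>g\<close> at the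
        centre of the surrounding ball. The three errors of size \<open>e / 3\<close> come from
        replacing \<open>g\<close> by \<open>h\<close> in the mean, from the convergence for
        \<open>h\<close>, and from replacing \<open>h\<close> by \<open>g\<close> in the
        integral.\<close>
      define h where "h x = (\<Sum>i<m k. g (c k i) * indicator (E k i) x)" for x
      have gh: "\<bar>g x - h x\<bar> \<le> e / 3" for x
      proof -
        have "x \<in> (\<Union>i<m k. E k i)"
          using cover[of k] finite_UN_disjointed_eq[of "\<lambda>i. ball (c k i) (1 / real (Suc k))" "m k"]
          unfolding E_def lessThan_atLeast0 by blast
        then obtain i where i: "i < m k" "x \<in> E k i" by blast
        have unique: "x \<in> E k j \<longleftrightarrow> j = i" for j
          using i(2) disj[of k] by (auto simp: disjoint_family_on_def)
        have "h x = (\<Sum>j\<in>{i}. g (c k j) * indicator (E k j) x)"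
          unfolding h_def using i unique by (intro sum.mono_neutral_right) auto
        then have "h x = g (c k i)" using i by simp
        moreover have "dist (c k i) x < d"
          using i k disjointed_subset[of "\<lambda>i. ball (c k i) (1 / real (Suc k))" i] by (force simp: E_def)
        ultimately show ?thesis using d[of "c k i" x] by (simp add: dist_real_def abs_minus_commute)
      qed
      have E_int: "integrable P (\<lambda>x. indicator (E k i) x :: real)" for i
        using E_sets by (intro integrable_real_indicator) (auto simp: P.emeasure_eq_measure)
      have h_int: "integrable P h"
        unfolding h_def by (intro Bochner_Integration.integrable_sum integrable_mult_right E_int)
      have "(\<integral>\<omega>. h \<omega> \<partial>P) = (\<Sum>i<m k. g (c k i) * measure P (E k i))"
        unfolding h_def using E_sets sets.sets_into_space[OF E_sets]
        by (subst Bochner_Integration.integral_sum) (auto simp: E_int Int_absorb2)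
      moreover have "cesaro (\<lambda>n. h (a n)) \<longlonglongrightarrow> (\<Sum>i<m k. g (c k i) * measure P (E k i))"
        unfolding h_def cesaro_sum cesaro_cmult by (intro tendsto_sum tendsto_mult tendsto_const aE)
      ultimately have h_close: "\<forall>\<^sub>F N in sequentially. dist (cesaro (\<lambda>n. h (a n)) N) (\<integral>\<omega>. h \<omega> \<partial>P) < e / 3"
        using \<open>e > 0\<close> by (intro tendstoD) simp_all
      have g_h: "\<bar>cesaro (\<lambda>n. g (a n)) N - cesaro (\<lambda>n. h (a n)) N\<bar> \<le> e / 3" for N
        unfolding cesaro_diff[symmetric] using gh \<open>e > 0\<close> by (intro abs_cesaro_le) auto
      have int_close: "\<bar>(\<integral>\<omega>. g \<omega> \<partial>P) - (\<integral>\<omega>. h \<omega> \<partial>P)\<bar> \<le> e / 3"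
      proof -
        have "\<bar>\<integral>\<omega>. g \<omega> - h \<omega> \<partial>P\<bar> \<le> (\<integral>\<omega>. \<bar>g \<omega> - h \<omega>\<bar> \<partial>P)" by (rule integral_abs_bound)
        also have "\<dots> \<le> (\<integral>\<omega>. e / 3 \<partial>P)"
          using gh g_int h_int by (intro integral_mono) auto
        finally show ?thesis using g_int h_int by (simp add: P.prob_space)
      qed
      from h_close show "\<forall>\<^sub>F N in sequentially. dist (cesaro (\<lambda>n. g (a n)) N) (\<integral>\<omega>. g \<omega> \<partial>P) < e"
      proof (rule eventually_mono)
        fix N assume "dist (cesaro (\<lambda>n. h (a n)) N) (\<integral>\<omega>. h \<omega> \<partial>P) < e / 3"
        then show "dist (cesaro (\<lambda>n. g (a n)) N) (\<integral>\<omega>. g \<omega> \<partial>P) < e"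
          using g_h[of N] int_close unfolding dist_real_def by linarith
      qed
    qed
  qed
  then show ?thesis using aB that by blast
qed

text \<open>Uniform continuity turns vanishing distances into vanishing differences of the values of
  \<open>g\<close>, whose means vanish too.\<close>

lemma uniformly_distributed_perturb:
  fixes P :: "'a::metric_space measure"
  assumes compact: "compact (UNIV :: 'a set)" and a: "uniformly_distributed P a"
    and dist: "(\<lambda>n. dist (x n) (a n)) \<longlonglongrightarrow> 0"
  shows "uniformly_distributed P x"
  unfolding uniformly_distributed_iff
proof (intro allI impI)
  fix g :: "'a \<Rightarrow> real" assume g: "continuous_on UNIV g"
  have "(\<lambda>n. dist (g (x n)) (g (a n))) \<longlonglongrightarrow> 0"
    using compact_uniformly_continuous[OF g compact] dist
    by (simp add: uniformly_continuous_on_sequentially)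
  then have "(\<lambda>n. g (x n) - g (a n)) \<longlonglongrightarrow> 0"
    by (simp add: dist_real_def tendsto_rabs_zero_iff)
  then have "cesaro (\<lambda>n. g (x n) - g (a n)) \<longlonglongrightarrow> 0" by (rule cesaro_tendsto_0)
  moreover have "cesaro (\<lambda>n. g (a n)) \<longlonglongrightarrow> (\<integral>\<omega>. g \<omega> \<partial>P)"
    using a g by (simp add: uniformly_distributed_iff)
  ultimately show "cesaro (\<lambda>n. g (x n)) \<longlonglongrightarrow> (\<integral>\<omega>. g \<omega> \<partial>P)"
    using tendsto_add[of _ 0] by (fastforce simp: cesaro_diff)
qed

section \<open>Closed sets and the density for members of the system\<close>

text \<open>The indicator of \<open>F\<close> lies below continuous functions whose integrals tend
  to \<open>measure P F\<close>; uniform distribution applies to one whose integral is close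
  enough.\<close>

lemma cesaro_closed_eventually_less:
  fixes P :: "'a::metric_space measure"
  assumes P: "prob_space P" and sets_P: "sets P = sets borel"
    and x: "uniformly_distributed P x" and F: "closed F" and e: "e > 0"
  shows "\<forall>\<^sub>F N in sequentially. cesaro (\<lambda>n. indicator F (x n)) N < measure P F + e"
\<comment> \<open>The empty set is separate because \<open>infdist y {} = 0\<close>, which would
  make every \<open>g k\<close> below constantly 1.\<close>
proof (cases "F = {}")
  case True
  then show ?thesis using e by (simp add: cesaro_def)
next
  case False
  interpret P: prob_space P by fact
  \<comment> \<open>A tent function: 1 on \<open>F\<close> and, for \<open>k > 0\<close>, 0 at
    distance at least \<open>1 / k\<close> from \<open>F\<close>.\<close>
  define g where "g k y = max 0 (1 - real k * infdist y F)" for k y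
  have g_cont: "continuous_on UNIV (g k)" for k
    unfolding g_def by (intro continuous_intros)
  have "(\<lambda>k. \<integral>y. g k y \<partial>P) \<longlonglongrightarrow> (\<integral>y. indicator F y \<partial>P)"
  proof (rule integral_dominated_convergence[where w="\<lambda>_. 1"])
    show "AE y in P. (\<lambda>k. g k y) \<longlonglongrightarrow> indicator F y"
    proof (intro AE_I2)
      fix y
      show "(\<lambda>k. g k y) \<longlonglongrightarrow> indicator F y"
      proof (cases "y \<in> F")
        case False
        then have pos: "infdist y F > 0" using F \<open>F \<noteq> {}\<close> by (simp add: infdist_pos_not_in_closed)
        then obtain k0 :: nat where k0: "1 / infdist y F < k0" using reals_Archimedean2 by blast
        have "g k y = 0" if "k \<ge> k0" for k
        proof -
          have "1 / infdist y F < k" using k0 that by linarith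
          then show ?thesis using pos by (simp add: g_def field_simps)
        qed
        then have "\<forall>\<^sub>F k in sequentially. g k y = 0" by (auto simp: eventually_sequentially)
        then show ?thesis using False by (simp add: tendsto_eventually)
      qed (simp add: g_def)
    qed
    show "AE y in P. norm (g k y) \<le> 1" for k
      by (intro AE_I2) (auto simp: g_def infdist_nonneg)
  qed (use F g_cont sets_P in \<open>auto intro!: borel_measurable_continuous_onI cong: measurable_cong_sets\<close>)
  moreover have "(\<integral>y. indicator F y \<partial>P) = measure P F"
    using F sets_P sets.sets_into_space[of F P] by (simp add: Int_absorb2 del: indicator_simps)
  ultimately have "\<forall>\<^sub>F k in sequentially. (\<integral>y. g k y \<partial>P) < measure P F + e"
    using e by (intro order_tendstoD(2)) auto
  then obtain k where k: "(\<integral>y. g k y \<partial>P) < measure P F + e"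
    by (auto simp: eventually_sequentially)
  have "cesaro (\<lambda>n. g k (x n)) \<longlonglongrightarrow> (\<integral>y. g k y \<partial>P)"
    using x g_cont by (simp add: uniformly_distributed_iff)
  from order_tendstoD(2)[OF this k] show ?thesis
  proof (rule eventually_mono)
    fix N assume "cesaro (\<lambda>n. g k (x n)) N < measure P F + e"
    moreover have "cesaro (\<lambda>n. indicator F (x n)) N \<le> cesaro (\<lambda>n. g k (x n)) N"
      by (rule cesaro_mono) (auto simp: g_def indicator_def)
    ultimately show "cesaro (\<lambda>n. indicator F (x n)) N < measure P F + e" by simp
  qed
qed

text \<open>The closed-set bound for \<open>S\<close> gives the upper estimate. The same bound for
  \<open>M - S\<close> gives the lower one, because both the frequencies and the values of
  \<open>pi_star\<close> on the two sets add up to 1.\<close>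

lemma cesaro_tendsto_closure:
  fixes P :: "'a::metric_space measure"
  assumes P: "prob_space P" and sets_P: "sets P = sets borel"
    and S: "S \<in> Y_system P M" and x: "sequence_in M x" "uniformly_distributed P x"
  shows "cesaro (\<lambda>n. indicator S (x n)) \<longlonglongrightarrow> pi_star P S"
proof (rule order_tendstoI)
  have less: "\<forall>\<^sub>F N in sequentially. cesaro (\<lambda>n. indicator T (x n)) N < b"
    if "pi_star P T < b" for T b
  proof (rule eventually_mono)
    show "\<forall>\<^sub>F N in sequentially. cesaro (\<lambda>n. indicator (closure T) (x n)) N
        < measure P (closure T) + (b - pi_star P T)"
      using that by (intro cesaro_closed_eventually_less[OF P sets_P x(2)]) auto
    fix N assume "cesaro (\<lambda>n. indicator (closure T) (x n)) N < measure P (closure T) + (b - pi_star P T)"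
    moreover have "cesaro (\<lambda>n. indicator T (x n)) N \<le> cesaro (\<lambda>n. indicator (closure T) (x n)) N"
      using closure_subset by (intro cesaro_mono) (auto simp: indicator_def)
    ultimately show "cesaro (\<lambda>n. indicator T (x n)) N < b" by (simp add: pi_star_def)
  qed
  fix b
  show "\<forall>\<^sub>F N in sequentially. cesaro (\<lambda>n. indicator S (x n)) N < b" if "pi_star P S < b"
    using less[OF that] .
  assume b: "b < pi_star P S"
  have "pi_star P (M - S) < 1 - b" using b S by (simp add: Y_system_def)
  \<comment> \<open>\<open>N > 0\<close> is required since the mean of the constant 1 is 0 at
    \<open>N = 0\<close>.\<close>
  from less[OF this] eventually_gt_at_top[of 0]
  show "\<forall>\<^sub>F N in sequentially. b < cesaro (\<lambda>n. indicator S (x n)) N"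
  proof eventually_elim
    case (elim N)
    have "cesaro (\<lambda>n. indicator S (x n) + indicator (M - S) (x n)) N = cesaro (\<lambda>n. 1) N"
      using x(1) by (intro fun_cong[OF cesaro_cong]) (auto simp: sequence_in_def indicator_def)
    then have "cesaro (\<lambda>n. indicator S (x n)) N + cesaro (\<lambda>n. indicator (M - S) (x n)) N = 1"
      using elim by (simp add: cesaro_add) (simp add: cesaro_def)
    with elim show ?case by simp
  qed
qed

section \<open>A sequence without density for sets outside the system\<close>

lemma closure_sequence_approx:
  fixes T :: "nat \<Rightarrow> 'a::metric_space set"
  assumes "\<And>n. a n \<in> closure (T n)"
  obtains y where "\<And>n. y n \<in> T n" "\<And>n. dist (y n) (a n) < 1 / real (Suc n)"
proof -
  have "\<exists>y\<in>T n. dist y (a n) < 1 / real (Suc n)" for n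
    using assms[of n] unfolding closure_approachable
    by (metis of_nat_0_less_iff zero_less_Suc zero_less_divide_1_iff)
  then show ?thesis using that by metis
qed

text \<open>Two approximations of \<open>a\<close> are built: \<open>y\<close> prefers
  \<open>S\<close> and \<open>z\<close> prefers \<open>M - S\<close>. Either one of them already
  fails to give a density, or their densities differ by the measure of the common boundary and a
  mixture oscillates.\<close>

lemma oscillating_sequence_exists:
  fixes P :: "'a::metric_space measure"
  assumes compact: "compact (UNIV :: 'a set)"
    and P: "prob_space P" and sets_P: "sets P = sets borel"
    and M: "closure M = UNIV" and S: "S \<subseteq> M" and not_Y: "S \<notin> Y_system P M"
  obtains x where "sequence_in M x" "uniformly_distributed P x"
    "\<not> convergent (cesaro (\<lambda>n. indicator S (x n)))"
proof -
  interpret P: prob_space P by fact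
  let ?F = "closure S" and ?G = "closure (M - S)"
  have "S \<union> (M - S) = M" using S by blast
  then have cover: "?F \<union> ?G = UNIV" using M closure_Un[of S "M - S"] by simp
  have sets: "?F \<in> sets P" "?G \<in> sets P" using sets_P by auto
  \<comment> \<open>Since the union is the whole space, the two values of \<open>pi_star\<close>
    exceed 1 by exactly the measure of the intersection.\<close>
  have "measure P ?F + measure P ?G = measure P (?F \<union> ?G) + measure P (?F \<inter> ?G)"
    using sets P.finite_measure_Union'[of ?F ?G] P.finite_measure_Diff'[of ?G ?F] by (simp add: Int_commute)
  moreover have "measure P UNIV = 1"
    using P.prob_space sets_P sets_eq_imp_space_eq[OF sets_P] by simp
  ultimately have K: "measure P (?F \<inter> ?G) \<noteq> 0"
    using not_Y S cover by (auto simp: Y_system_def pi_star_def)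
  obtain a where a: "uniformly_distributed P a"
    and aK: "cesaro (\<lambda>n. indicator (?F \<inter> ?G) (a n)) \<longlonglongrightarrow> measure P (?F \<inter> ?G)"
    using uniformly_distributed_exists[OF compact P sets_P sets.Int[OF sets]] by blast
  obtain y where y: "\<And>n. y n \<in> (if a n \<in> ?F then S else M - S)" "\<And>n. dist (y n) (a n) < 1 / real (Suc n)"
    by (rule closure_sequence_approx[of a "\<lambda>n. if a n \<in> ?F then S else M - S"]) (use cover in auto)
  obtain z where z: "\<And>n. z n \<in> (if a n \<in> ?G then M - S else S)" "\<And>n. dist (z n) (a n) < 1 / real (Suc n)"
    by (rule closure_sequence_approx[of a "\<lambda>n. if a n \<in> ?G then M - S else S"]) (use cover in auto)
  \<comment> \<open>Stated for every termwise mixture, so that it covers \<open>y\<close>,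
    \<open>z\<close> and the final switching sequence at once.\<close>
  have good: "sequence_in M w \<and> uniformly_distributed P w" if w: "\<And>n. w n = y n \<or> w n = z n" for w
  proof
    have "w n \<in> M" for n using w[of n] y(1)[of n] z(1)[of n] S by (auto split: if_splits)
    then show "sequence_in M w" by (simp add: sequence_in_def)
    have "norm (dist (w n) (a n)) \<le> 1 / real (Suc n)" for n
      using w[of n] y(2)[of n] z(2)[of n] by auto
    then have "(\<lambda>n. dist (w n) (a n)) \<longlonglongrightarrow> 0"
      by (intro Lim_null_comparison[OF _ LIMSEQ_Suc[OF lim_1_over_n]] always_eventually) simp
    then show "uniformly_distributed P w" by (rule uniformly_distributed_perturb[OF compact a])
  qed
  let ?u = "\<lambda>n. indicator S (y n) :: real" and ?v = "\<lambda>n. indicator S (z n) :: real"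
  show ?thesis
  proof (cases "convergent (cesaro ?u) \<and> convergent (cesaro ?v)")
    case False
    then show ?thesis using that good[of y] good[of z] by blast
  next
    case True
    then obtain \<alpha> \<beta> where u: "cesaro ?u \<longlonglongrightarrow> \<alpha>" and v: "cesaro ?v \<longlonglongrightarrow> \<beta>"
      by (auto simp: convergent_def)
    \<comment> \<open>If \<open>a n\<close> lies in only one of the closures, \<open>y n\<close> and
      \<open>z n\<close> fall on the same side; in the intersection \<open>y n\<close> is in
      \<open>S\<close> and \<open>z n\<close> is not.\<close>
    have "?u n - ?v n = indicator (?F \<inter> ?G) (a n)" for n
      using y(1)[of n] z(1)[of n] cover by (auto simp: indicator_def split: if_splits)
    then have "cesaro (\<lambda>n. ?u n - ?v n) \<longlonglongrightarrow> measure P (?F \<inter> ?G)" using aK by simp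
    moreover have "cesaro (\<lambda>n. ?u n - ?v n) \<longlonglongrightarrow> \<alpha> - \<beta>"
      unfolding cesaro_diff by (intro tendsto_diff u v)
    ultimately have "\<alpha> \<noteq> \<beta>" using K LIMSEQ_unique by fastforce
    then obtain W where W: "\<not> convergent (cesaro (\<lambda>n. if n \<in> W then ?u n else ?v n))"
      by (rule oscillating_choice[OF u v]) (auto simp: indicator_def)
    let ?w = "\<lambda>n. if n \<in> W then y n else z n"
    have "(\<lambda>n. if n \<in> W then ?u n else ?v n) = (\<lambda>n. indicator S (?w n))" by auto
    then show ?thesis using W good[of ?w] that[of ?w] by auto
  qed
qed

theorem corollary1:
  fixes P :: "'a::metric_space measure" and M S :: "'a set"
  assumes "compact (UNIV :: 'a set)"
    and "prob_space P" and "sets P = sets borel"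
    and "closure M = UNIV"
    and "S \<subseteq> M"
  shows "(S \<in> Y_system P M \<longleftrightarrow>
      (\<forall>x. sequence_in M x \<and> uniformly_distributed P x \<longrightarrow> index_set x S \<in> has_density_sets)) \<and>
    (S \<in> Y_system P M \<longrightarrow>
      (\<forall>x. sequence_in M x \<and> uniformly_distributed P x \<longrightarrow>
        asymp_density (index_set x S) = pi_content P M S))"
proof -
  \<comment> \<open>One limit yields both the existence and the value of the density; membership in
    the system also resolves the \<open>restrict\<close> in \<open>pi_content\<close>.\<close>
  have lim: "density_ratio (index_set x S) \<longlonglongrightarrow> pi_content P M S"
    if "S \<in> Y_system P M" "sequence_in M x" "uniformly_distributed P x" for x
    using cesaro_tendsto_closure[OF assms(2,3) that] that(1)
    by (simp add: density_ratio_eq_cesaro pi_content_def)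
  moreover have "\<exists>x. sequence_in M x \<and> uniformly_distributed P x \<and> index_set x S \<notin> has_density_sets"
    if "S \<notin> Y_system P M"
    using oscillating_sequence_exists[OF assms that]
    by (auto simp: has_density_sets_def density_ratio_eq_cesaro)
  ultimately show ?thesis
    by (auto simp: has_density_sets_def asymp_density_def convergent_def dest: limI)
qed

end
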